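(* Let $G$ be a finite, simple, connected graph. Then $$\mathrm{Sz}^*(G) = \frac{1}{2} \sum_{u, v \in V(G)} \left( \mathrm{dis}_G(u, v) + \mathrm{deq}_G(u, u) - \frac{1}{2}\, \mathrm{deq}_G(u, v) \right),$$ where the sum runs over all ordered pairs $(u,v) \in V(G) \times V(G)$ (including $u = v$).
   Context: $V(G)$ and $E(G)$ are the vertex set and edge set of $G$; $d_G(u,v)$ is the distance (length of a shortest path) between $u$ and $v$ in $G$. For vertices $s,t$, $n_G(s,t)$ is the number of vertices $w$ of $G$ with $d_G(w,s) < d_G(w,t)$, and $o_G(s,t)$ is the number of vertices $w$ with $d_G(w,s) = d_G(w,t)$. The revised Szeged index is $$\mathrm{Sz}^*(G) = \sum_{\{s,t\} \in E(G)} \left(n_G(s,t) + \tfrac12 o_G(s,t)\right)\left(n_G(t,s) + \tfrac12 o_G(t,s)\right).$$ An edge $\{s,t\}$ is $(u,v)$-distance-disparate if either $d_G(u,s) < d_G(u,t)$ and $d_G(v,s) > d_G(v,t)$, or $d_G(u,s) > d_G(u,t)$ and $d_G(v,s) < d_G(v,t)$; $\mathrm{dis}_G(u,v)$ is the number of $(u,v)$-distance-disparate edges of $G$. An edge $\{s,t\}$ is $(u,v)$-distance-equal if $d_G(u,s) = d_G(u,t)$ and $d_G(v,s) = d_G(v,t)$; $\mathrm{deq}_G(u,v)$ is the number of $(u,v)$-distance-equal edges of $G$. *)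

theory Defs
  imports Complex_Main
begin

text \<open>
  A simple graph is given by a vertex set and a set of edges, each edge being an unordered pair of
  distinct vertices. A path is the list of its (pairwise distinct) vertices, so a path of length
  \<open>n\<close> is a list with \<open>n + 1\<close> entries.
\<close>

locale finite_simple_graph =
  fixes V :: "'a set" and E :: "'a set set"
  assumes finite_V: "finite V"
    and edge_wf: "e \<in> E \<Longrightarrow> \<exists>s t. s \<in> V \<and> t \<in> V \<and> s \<noteq> t \<and> e = {s, t}"

definition path_between :: "'a set \<Rightarrow> 'a set set \<Rightarrow> 'a \<Rightarrow> 'a list \<Rightarrow> 'a \<Rightarrow> bool" where
  "path_between V E u p v \<longleftrightarrow>
     p \<noteq> [] \<and> hd p = u \<and> last p = v \<and> set p \<subseteq> V \<and> distinct p \<and>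
     successively (\<lambda>x y. {x, y} \<in> E) p"

locale connected_simple_graph = finite_simple_graph +
  assumes connected: "u \<in> V \<Longrightarrow> v \<in> V \<Longrightarrow> \<exists>p. path_between V E u p v"

text \<open>Only meaningful for vertices joined by some path.\<close>

definition gdist :: "'a set \<Rightarrow> 'a set set \<Rightarrow> 'a \<Rightarrow> 'a \<Rightarrow> nat" where
  "gdist V E u v = (LEAST n. \<exists>p. path_between V E u p v \<and> length p = n + 1)"

definition n_closer :: "'a set \<Rightarrow> 'a set set \<Rightarrow> 'a \<Rightarrow> 'a \<Rightarrow> nat" where
  "n_closer V E s t = card {w \<in> V. gdist V E w s < gdist V E w t}"

definition n_equidistant :: "'a set \<Rightarrow> 'a set set \<Rightarrow> 'a \<Rightarrow> 'a \<Rightarrow> nat" where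
  "n_equidistant V E s t = card {w \<in> V. gdist V E w s = gdist V E w t}"

definition szeged_term :: "'a set \<Rightarrow> 'a set set \<Rightarrow> 'a \<Rightarrow> 'a \<Rightarrow> real" where
  "szeged_term V E s t =
     (real (n_closer V E s t) + 1 / 2 * real (n_equidistant V E s t)) *
     (real (n_closer V E t s) + 1 / 2 * real (n_equidistant V E t s))"

text \<open>
  The summand is symmetric in the two ends of an edge, so it depends only on the unordered edge
  \<open>e\<close>, and the description below denotes the common value; see
  \<open>szeged_edge_eq\<close>.
\<close>

definition szeged_edge :: "'a set \<Rightarrow> 'a set set \<Rightarrow> 'a set \<Rightarrow> real" where
  "szeged_edge V E e = (THE x. \<exists>s t. e = {s, t} \<and> x = szeged_term V E s t)"

lemma szeged_term_commute: "szeged_term V E s t = szeged_term V E t s"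
  by (simp add: szeged_term_def mult.commute)

lemma szeged_edge_eq: "szeged_edge V E {s, t} = szeged_term V E s t"
  unfolding szeged_edge_def
  by (rule the_equality) (auto simp: doubleton_eq_iff szeged_term_commute)

definition revised_szeged :: "'a set \<Rightarrow> 'a set set \<Rightarrow> real" where
  "revised_szeged V E = (\<Sum>e\<in>E. szeged_edge V E e)"

definition distance_disparate :: "'a set \<Rightarrow> 'a set set \<Rightarrow> 'a \<Rightarrow> 'a \<Rightarrow> 'a set \<Rightarrow> bool" where
  "distance_disparate V E u v e \<longleftrightarrow>
     (\<exists>s t. e = {s, t} \<and>
        ((gdist V E u s < gdist V E u t \<and> gdist V E v s > gdist V E v t) \<or>
         (gdist V E u s > gdist V E u t \<and> gdist V E v s < gdist V E v t)))"

definition distance_equal :: "'a set \<Rightarrow> 'a set set \<Rightarrow> 'a \<Rightarrow> 'a \<Rightarrow> 'a set \<Rightarrow> bool" where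
  "distance_equal V E u v e \<longleftrightarrow>
     (\<exists>s t. e = {s, t} \<and> gdist V E u s = gdist V E u t \<and> gdist V E v s = gdist V E v t)"

definition dis :: "'a set \<Rightarrow> 'a set set \<Rightarrow> 'a \<Rightarrow> 'a \<Rightarrow> nat" where
  "dis V E u v = card {e \<in> E. distance_disparate V E u v e}"

definition deq :: "'a set \<Rightarrow> 'a set set \<Rightarrow> 'a \<Rightarrow> 'a \<Rightarrow> nat" where
  "deq V E u v = card {e \<in> E. distance_equal V E u v e}"

end

theory Submission
  imports Defs
begin

text \<open>
  Exchange the order of summation, so that the right-hand side becomes a sum over edges. For a fixed
  edge \<open>{s, t}\<close>, let \<open>a\<close> vertices be closer to \<open>s\<close>, \<open>b\<close> closer to \<open>t\<close> and \<open>c\<close> equidistant. The edge is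
  disparate for \<open>2ab\<close> ordered pairs, and it contributes \<open>c(a + b + c)\<close> to the middle term and
  \<open>c\<^sup>2\<close> to the last one, so its total contribution is
  \<open>ab + c(a + b + c)/2 - c\<^sup>2/4 = (a + c/2)(b + c/2)\<close>.
\<close>

lemma (in finite_simple_graph) finite_E: "finite E"
proof (rule finite_subset)
  show "E \<subseteq> Pow V"
    using edge_wf by fastforce
qed (simp add: finite_V)

text \<open>Swapping the two ends exchanges the two disjuncts, so the existential over ways of
  writing the edge collapses to the given one.\<close>

lemma distance_disparate_pair_iff:
  "distance_disparate V E u v {s, t} \<longleftrightarrow>
     gdist V E u s < gdist V E u t \<and> gdist V E v t < gdist V E v s \<or>
     gdist V E u t < gdist V E u s \<and> gdist V E v s < gdist V E v t"
  unfolding distance_disparate_def by (auto simp: doubleton_eq_iff)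

lemma distance_equal_pair_iff:
  "distance_equal V E u v {s, t} \<longleftrightarrow>
     gdist V E u s = gdist V E u t \<and> gdist V E v s = gdist V E v t"
  unfolding distance_equal_def by (auto simp: doubleton_eq_iff)

lemma real_card_eq_sum_of_bool:
  "finite A \<Longrightarrow> real (card {x \<in> A. P x}) = (\<Sum>x\<in>A. of_bool (P x))"
  by (simp add: sum_of_bool_eq Int_def)

text \<open>The contribution of a single edge. The factor 2 arises from ordered pairs and cancels
  the 1/2 of the theorem.\<close>

lemma sum_pairs_eq_szeged_edge:
  assumes "finite V"
  shows "(\<Sum>(u, v)\<in>V \<times> V. of_bool (distance_disparate V E u v {s, t})
            + of_bool (distance_equal V E u u {s, t})
            - 1 / 2 * of_bool (distance_equal V E u v {s, t}))
         = 2 * szeged_edge V E {s, t}"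
proof -
  define a b c :: "'a \<Rightarrow> real"
    where "a = (\<lambda>w. of_bool (gdist V E w s < gdist V E w t))"
      and "b = (\<lambda>w. of_bool (gdist V E w t < gdist V E w s))"
      and "c = (\<lambda>w. of_bool (gdist V E w s = gdist V E w t))"
  have closer: "real (n_closer V E s t) = sum a V" "real (n_closer V E t s) = sum b V"
    and equidistant: "real (n_equidistant V E s t) = sum c V"
    "real (n_equidistant V E t s) = sum c V"
    using assms unfolding n_closer_def n_equidistant_def a_def b_def c_def
    \<comment> \<open>\<open>n_equidistant V E t s\<close> has its equation the other way round;
      \<open>eq_commute\<close> turns it so that both counts become \<open>sum c V\<close>.\<close>
    by (simp_all only: real_card_eq_sum_of_bool eq_commute[of "gdist V E _ t"])
  \<comment> \<open>The identity holds pair by pair: by trichotomy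
    \<open>a v + b v + c v = 1\<close>, so \<open>c u - 1 / 2 * (c u * c v)\<close> expands to the
    last three products. Every summand then separates into a factor in \<open>u\<close> and one in
    \<open>v\<close>.\<close>
  have "(\<Sum>(u, v)\<in>V \<times> V. of_bool (distance_disparate V E u v {s, t})
            + of_bool (distance_equal V E u u {s, t})
            - 1 / 2 * of_bool (distance_equal V E u v {s, t}))
      = (\<Sum>(u, v)\<in>V \<times> V. a u * b v + b u * a v + c u * a v + c u * b v + 1 / 2 * (c u * c v))"
    unfolding distance_disparate_pair_iff distance_equal_pair_iff a_def b_def c_def
    by (intro sum.cong refl) (auto split: prod.split)
  also have "\<dots> = sum a V * sum b V + sum b V * sum a V + sum c V * sum a V + sum c V * sum b V
      + 1 / 2 * (sum c V * sum c V)"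
    by (simp only: sum.cartesian_product[symmetric] sum.distrib
        sum_distrib_left[symmetric] sum_distrib_right[symmetric])
  also have "\<dots> = 2 * szeged_edge V E {s, t}"
    unfolding szeged_edge_eq szeged_term_def closer equidistant by (simp add: field_simps)
  finally show ?thesis .
qed

theorem theorem2p1:
  fixes V :: "'a set" and E :: "'a set set"
  assumes "connected_simple_graph V E"
  shows "revised_szeged V E =
    1 / 2 * (\<Sum>(u, v)\<in>V \<times> V.
      real (dis V E u v) + real (deq V E u u) - 1 / 2 * real (deq V E u v))"
proof -
  interpret connected_simple_graph V E by fact
  have "(\<Sum>(u, v)\<in>V \<times> V. real (dis V E u v) + real (deq V E u u) - 1 / 2 * real (deq V E u v))
      = (\<Sum>(u, v)\<in>V \<times> V. \<Sum>e\<in>E. of_bool (distance_disparate V E u v e)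
            + of_bool (distance_equal V E u u e) - 1 / 2 * of_bool (distance_equal V E u v e))"
    unfolding dis_def deq_def
    by (simp only: real_card_eq_sum_of_bool[OF finite_E] sum.distrib sum_subtractf sum_distrib_left)
  also have "\<dots> = (\<Sum>e\<in>E. \<Sum>(u, v)\<in>V \<times> V. of_bool (distance_disparate V E u v e)
            + of_bool (distance_equal V E u u e) - 1 / 2 * of_bool (distance_equal V E u v e))"
    \<comment> \<open>With projections in place of the pair pattern, the inner sum is directly the
      body of the outer one, as \<open>sum.swap\<close> requires.\<close>
    unfolding case_prod_unfold by (rule sum.swap)
  also have "\<dots> = (\<Sum>e\<in>E. 2 * szeged_edge V E e)"
  proof (rule sum.cong[OF refl])
    fix e assume "e \<in> E"
    then obtain s t where "e = {s, t}"
      using edge_wf by blast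
    then show "(\<Sum>(u, v)\<in>V \<times> V. of_bool (distance_disparate V E u v e)
            + of_bool (distance_equal V E u u e) - 1 / 2 * of_bool (distance_equal V E u v e))
        = 2 * szeged_edge V E e"
      by (simp only: sum_pairs_eq_szeged_edge[OF finite_V])
  qed
  also have "\<dots> = 2 * revised_szeged V E"
    by (simp only: revised_szeged_def sum_distrib_left)
  finally show ?thesis by simp
qed

end
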